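(* Let $N\geq2$ and $d\geq1$, and let $\Gamma$ be a group of invertible affine maps of $\mathbb Z_N^d$ that preserves a nonempty set $S\subseteq\mathbb Z_N^d$ and acts transitively on it. Then, for $1\leq r<\infty$, $$\mathcal C_r(S)=\frac{N^{-\frac{d}{2}}|S|}{\|\widehat{1_S}\|_r}.$$ For $1<r<\infty$, the nonzero functions $f$ supported on $S$ attaining equality, i.e. satisfying $\|\widehat f\|_\infty=\mathcal C_r(S)\|\widehat f\|_r$, are exactly the scalar multiples of modulated indicators, $$f(x)=c\,e^{\frac{2\pi i x\cdot\xi_0}{N}}1_S(x),\qquad c\in\mathbb C,\ c\neq0,\ \xi_0\in\mathbb Z_N^d .$$
   Context: $\mathbb Z_N=\mathbb Z/N\mathbb Z$. For $f:\mathbb Z_N^d\to\mathbb C$ the unitary Fourier transform is $\widehat f(\xi)=N^{-d/2}\sum_{x\in\mathbb Z_N^d}f(x)e^{-2\pi i x\cdot\xi/N}$. All norms use counting measure: $\|f\|_r=(\sum_x|f(x)|^r)^{1/r}$, $\|f\|_\infty=\max_x|f(x)|$. $1_S$ is the indicator of $S$. An invertible affine map of $\mathbb Z_N^d$ has the form $T(x)=Ax+b$ with $A$ a $d\times d$ matrix invertible over $\mathbb Z_N$ and $b\in\mathbb Z_N^d$. For nonempty $S\subseteq\mathbb Z_N^d$ and $1\le r<\infty$, the synthesis constant is $$\mathcal C_r(S)=\sup_{f\neq0,\ \operatorname{supp}(f)\subseteq S}\frac{\|\widehat f\|_\infty}{\|\widehat f\|_r},$$ the supremum being over complex-valued functions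 on $\mathbb Z_N^d$. *)

theory Defs
  imports
    "HOL-Analysis.Analysis"
    "HOL-Algebra.Bij"
    "Berlekamp_Zassenhaus.Finite_Field"
begin

text \<open>The ring of integers modulo \<open>N\<close> is \<open>'n mod_ring\<close> with \<open>N = CARD('n)\<close>; the class \<open>nontriv\<close> says
  exactly \<open>N \<ge> 2\<close>. Its \<open>d\<close>-th power is \<open>('n mod_ring) ^ 'd\<close> with \<open>d = CARD('d) \<ge> 1\<close>.\<close>

definition zdot :: "('n::nontriv mod_ring) ^ 'd \<Rightarrow> ('n mod_ring) ^ 'd \<Rightarrow> 'n mod_ring"  (infix \<open>\<odot>\<close> 70)
  where "x \<odot> y = (\<Sum>i\<in>UNIV. x $ i * y $ i)"

text \<open>\<open>exp (2 \<pi> \<i> t / N)\<close>; the value does not depend on the integer representing the residue \<open>t\<close>,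
  so the representative in \<open>{0..<N}\<close> is used.\<close>

definition echar :: "'n::nontriv mod_ring \<Rightarrow> complex"
  where "echar t = exp (2 * of_real pi * \<i> * of_int (to_int_mod_ring t) / of_nat CARD('n))"

definition fourier :: "(('n::nontriv mod_ring) ^ 'd \<Rightarrow> complex) \<Rightarrow> ('n mod_ring) ^ 'd \<Rightarrow> complex"
  where "fourier f \<xi> =
    of_real (real CARD('n) powr (- real CARD('d) / 2)) * (\<Sum>x\<in>UNIV. f x * echar (- (x \<odot> \<xi>)))"

definition lnorm :: "real \<Rightarrow> ('a::finite \<Rightarrow> complex) \<Rightarrow> real"
  where "lnorm r f = (\<Sum>x\<in>UNIV. cmod (f x) powr r) powr (1 / r)"

definition linfnorm :: "('a::finite \<Rightarrow> complex) \<Rightarrow> real"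
  where "linfnorm f = Max (range (\<lambda>x. cmod (f x)))"

definition supp :: "('a \<Rightarrow> complex) \<Rightarrow> 'a set"
  where "supp f = {x. f x \<noteq> 0}"

definition synthesis_const :: "real \<Rightarrow> (('n::nontriv mod_ring) ^ 'd) set \<Rightarrow> real"
  where "synthesis_const r S =
    Sup {linfnorm (fourier f) / lnorm r (fourier f) | f. f \<noteq> (\<lambda>_. 0) \<and> supp f \<subseteq> S}"

text \<open>The real-valued supremum above is a genuine one: the set is bounded above (and it is nonempty
  whenever \<open>S\<close> is).\<close>

lemma linfnorm_le_lnorm:
  fixes g :: "'a::finite \<Rightarrow> complex"
  assumes "r \<ge> 1"
  shows "linfnorm g \<le> lnorm r g"
proof -
  have "linfnorm g \<in> range (\<lambda>x. cmod (g x))"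
    unfolding linfnorm_def by (rule Max_in) auto
  then obtain x where x: "linfnorm g = cmod (g x)" by auto
  have "cmod (g x) powr r \<le> (\<Sum>y\<in>UNIV. cmod (g y) powr r)"
    by (rule member_le_sum) auto
  then have "(cmod (g x) powr r) powr (1 / r) \<le> lnorm r g"
    unfolding lnorm_def using assms by (intro powr_mono2) auto
  moreover have "(cmod (g x) powr r) powr (1 / r) = cmod (g x)"
    using assms by (simp add: powr_powr)
  ultimately show ?thesis using x by simp
qed

lemma bdd_above_synthesis:
  fixes S :: "(('n::nontriv mod_ring) ^ 'd) set"
  assumes "r \<ge> 1"
  shows "bdd_above {linfnorm (fourier f) / lnorm r (fourier f) | f. f \<noteq> (\<lambda>_. 0) \<and> supp f \<subseteq> S}"
proof (rule bdd_aboveI[where M = 1])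
  fix c
  assume "c \<in> {linfnorm (fourier f) / lnorm r (fourier f) | f. f \<noteq> (\<lambda>_. 0) \<and> supp f \<subseteq> S}"
  then obtain f :: "('n mod_ring) ^ 'd \<Rightarrow> complex" where c: "c = linfnorm (fourier f) / lnorm r (fourier f)" by blast
  have "lnorm r (fourier f) \<ge> 0" by (simp add: lnorm_def)
  then show "c \<le> 1"
    using linfnorm_le_lnorm[OF assms, of "fourier f"] by (simp add: c divide_le_eq_1 less_le)
qed

definition invertible_affine :: "(('n::nontriv mod_ring) ^ 'd \<Rightarrow> ('n mod_ring) ^ 'd) \<Rightarrow> bool"
  where "invertible_affine T \<longleftrightarrow>
    (\<exists>(A :: ('n mod_ring) ^ 'd ^ 'd) b. invertible A \<and> T = (\<lambda>x. A *v x + b))"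

text \<open>\<open>BijGroup UNIV\<close> is the group of all bijections under composition.\<close>

definition affine_group :: "(('n::nontriv mod_ring) ^ 'd \<Rightarrow> ('n mod_ring) ^ 'd) set \<Rightarrow> bool"
  where "affine_group \<Gamma> \<longleftrightarrow> subgroup \<Gamma> (BijGroup UNIV) \<and> (\<forall>T\<in>\<Gamma>. invertible_affine T)"

definition preserves :: "('a \<Rightarrow> 'a) set \<Rightarrow> 'a set \<Rightarrow> bool"
  where "preserves \<Gamma> S \<longleftrightarrow> (\<forall>T\<in>\<Gamma>. T ` S = S)"

definition acts_transitively_on :: "('a \<Rightarrow> 'a) set \<Rightarrow> 'a set \<Rightarrow> bool"
  where "acts_transitively_on \<Gamma> S \<longleftrightarrow> (\<forall>x\<in>S. \<forall>y\<in>S. \<exists>T\<in>\<Gamma>. T x = y)"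

end

theory Submission
  imports Defs
begin

text \<open>A modulation of \<open>f\<close> translates its transform, so the maximum of \<open>|f^|\<close> may be assumed to sit at
  the origin, where \<open>f^\<close> is a multiple of the mean of \<open>f\<close>. Averaging \<open>f \<circ> T\<close> over \<open>T \<in> \<Gamma>\<close> keeps that mean and,
  by transitivity, yields a multiple of \<open>1\<^sub>S\<close>. Each \<open>f \<circ> T\<close> has the same \<open>|f^|\<close> up to a permutation of
  frequencies, so by convexity of \<open>|z|\<^sup>r\<close> averaging does not increase the norm of the transform. For
  \<open>r > 1\<close> strict convexity makes equality force all \<open>f \<circ> T\<close> to agree, so \<open>f\<close> is constant on \<open>S\<close>.\<close>

section \<open>Convexity of the powers of a norm and the equality case of Jensen's
  inequality\<close>

text \<open>Strict convexity of \<open>t powr r\<close> on the nonnegative reals, in tangent form at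
  \<open>u\<close>. For \<open>u > 0\<close> both sides are homogeneous of degree \<open>r\<close>,
  so scaling by \<open>u\<close> reduces it to the tangent at 1.\<close>

lemma tangent_powr:
  fixes x u r :: real
  assumes "r > 1" "x \<ge> 0" "u \<ge> 0" "x \<noteq> u"
  shows "u powr r + r * u powr (r - 1) * (x - u) < x powr r"
proof -
  \<comment> \<open>Bernoulli's inequality. For \<open>y > 0\<close> it is y^(r-1) >= 1 + (r-1) ln y
    > 1 + (r-1)(1 - 1/y), multiplied by \<open>y\<close>; the strict step is ln y > 1 - 1/y for y
    different from 1.\<close>
  have base: "1 + r * (y - 1) < y powr r" if "y \<ge> 0" "y \<noteq> 1" for y :: real
  proof (cases "y = 0")
    case True
    then show ?thesis using \<open>r > 1\<close> by simp
  next
    case False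
    then have y: "y > 0" using that by simp
    have "ln (1 / y) < 1 / y - 1"
      using ln_le_minus_one[of "1 / y"] ln_eq_minus_one[of "1 / y"] y \<open>y \<noteq> 1\<close> by fastforce
    then have "1 - 1 / y < ln y" using y by (simp add: ln_div)
    then have "(r - 1) * (1 - 1 / y) < (r - 1) * ln y" using \<open>r > 1\<close> by simp
    also have "1 + \<dots> \<le> exp ((r - 1) * ln y)" by (rule exp_ge_add_one_self)
    finally have "1 + (r - 1) * (1 - 1 / y) < exp ((r - 1) * ln y)" by simp
    then have "y * (1 + (r - 1) * (1 - 1 / y)) < y * y powr (r - 1)"
      using y by (simp add: powr_def)
    also have "y * y powr (r - 1) = y powr r" using y by (simp add: powr_diff)
    also have "y * (1 + (r - 1) * (1 - 1 / y)) = 1 + r * (y - 1)"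
      using y by (simp add: field_simps)
    finally show ?thesis .
  qed
  show ?thesis
  proof (cases "u = 0")
    case True
    then show ?thesis using assms by simp
  next
    case False
    then have u: "u > 0" using assms by simp
    have "u powr r * (1 + r * (x / u - 1)) < u powr r * (x / u) powr r"
      using base[of "x / u"] u assms by simp
    also have "\<dots> = x powr r" using u assms by (simp add: powr_divide)
    also have "u powr r * (1 + r * (x / u - 1)) = u powr r + r * u powr (r - 1) * (x - u)"
      using u by (simp add: powr_diff field_simps)
    finally show ?thesis .
  qed
qed

text \<open>The linear term is the derivative of |z|^r at \<open>m\<close>. Cauchy-Schwarz bounds it
  by the derivative along the radius, which leaves the scalar inequality for the two norms. At
  \<open>m = 0\<close> the convention that 0 \<open>powr\<close> anything is 0 removes the linear
  term, also for \<open>r < 2\<close>.\<close>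

lemma norm_powr_tangent_strict:
  fixes z m :: "'a::real_inner"
  assumes "r > 1" "z \<noteq> m"
  shows "norm m powr r + r * norm m powr (r - 2) * ((z - m) \<bullet> m) < norm z powr r"
proof (cases "m = 0")
  case True
  then show ?thesis using assms by simp
next
  case False
  then have m: "norm m > 0" by simp
  have a: "norm m powr (r - 1) = norm m powr (r - 2) * norm m"
    using m powr_add[of "norm m" "r - 2" 1] by simp
  have le: "z \<bullet> m \<le> norm z * norm m" by (rule norm_cauchy_schwarz)
  have eq: "(z - m) \<bullet> m = z \<bullet> m - norm m * norm m"
    by (simp add: inner_diff_left power2_norm_eq_inner power2_eq_square[symmetric])
  show ?thesis
  proof (cases "norm z = norm m")
    case True
    \<comment> \<open>On the sphere through \<open>m\<close> the scalar inequality is not strict.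
      Strictness comes from expanding |z - m|^2 > 0, which makes the linear term negative.\<close>
    have "(z - m) \<bullet> (z - m) > 0" using assms by simp
    also have "(z - m) \<bullet> (z - m) = z \<bullet> z - m \<bullet> m - 2 * ((z - m) \<bullet> m)"
      by (simp add: inner_diff_left inner_diff_right inner_commute)
    also have "z \<bullet> z = m \<bullet> m"
      using True by (metis power2_norm_eq_inner)
    finally have "(z - m) \<bullet> m < 0" by simp
    then have "r * norm m powr (r - 2) * ((z - m) \<bullet> m) < 0"
      using m assms by (intro mult_pos_neg mult_pos_pos) auto
    then show ?thesis using True by simp
  next
    case False
    have "r * norm m powr (r - 2) * ((z - m) \<bullet> m)
        \<le> r * norm m powr (r - 2) * (norm m * (norm z - norm m))"
      using le eq assms by (intro mult_left_mono) (auto simp: algebra_simps)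
    also have "\<dots> = r * norm m powr (r - 1) * (norm z - norm m)"
      by (simp add: a)
    finally show ?thesis
      using tangent_powr[OF assms(1) norm_ge_zero norm_ge_zero False] by linarith
  qed
qed

text \<open>The endpoint \<open>r = 1\<close> is treated apart, by Cauchy-Schwarz: the norm is
  linear along rays, so the strict version fails there.\<close>

lemma norm_powr_tangent:
  fixes z m :: "'a::real_inner"
  assumes "r \<ge> 1"
  shows "norm m powr r + r * norm m powr (r - 2) * ((z - m) \<bullet> m) \<le> norm z powr r"
proof (cases "r = 1")
  case True
  show ?thesis
  proof (cases "m = 0")
    case False
    have "norm m powr (-1) * ((z - m) \<bullet> m) = (z \<bullet> m) / norm m - norm m"
      using False by (simp add: powr_minus inner_diff_left dot_square_norm field_simps power2_eq_square)
    moreover have "(z \<bullet> m) / norm m \<le> norm z"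
      using False norm_cauchy_schwarz[of z m] by (simp add: divide_le_eq)
    ultimately show ?thesis using True by simp
  qed (use True in simp)
next
  case False
  then show ?thesis
    using norm_powr_tangent_strict[of r z m] assms by (cases "z = m") auto
qed

text \<open>The deviations from the mean sum to zero, so the linear terms cancel. Summing the
  tangent inequality at the mean therefore yields Jensen's inequality.\<close>

lemma sum_tangent_average:
  fixes z :: "'i \<Rightarrow> 'a::real_inner"
  assumes "finite I" "I \<noteq> {}" "m = (\<Sum>i\<in>I. z i) /\<^sub>R real (card I)"
  shows "(\<Sum>i\<in>I. norm m powr r + r * norm m powr (r - 2) * ((z i - m) \<bullet> m))
    = real (card I) * norm m powr r"
proof -
  have "(\<Sum>i\<in>I. z i - m) = 0"
    using assms by (simp add: sum_subtractf sum_constant_scaleR)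
  then have "(\<Sum>i\<in>I. (z i - m) \<bullet> m) = 0"
    by (metis inner_sum_left inner_zero_left)
  then show ?thesis
    by (simp add: sum.distrib flip: sum_distrib_left)
qed

lemma norm_average_powr_le:
  fixes z :: "'i \<Rightarrow> 'a::real_inner"
  assumes "finite I" "I \<noteq> {}" "r \<ge> 1"
  shows "real (card I) * norm ((\<Sum>i\<in>I. z i) /\<^sub>R real (card I)) powr r \<le> (\<Sum>i\<in>I. norm (z i) powr r)"
  unfolding sum_tangent_average[OF assms(1,2) refl, of z r, symmetric]
  using assms by (intro sum_mono norm_powr_tangent)

text \<open>A single \<open>z i\<close> away from the mean makes its tangent inequality strict,
  hence also the sum.\<close>

lemma norm_average_powr_eqD:
  fixes z :: "'i \<Rightarrow> 'a::real_inner"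
  assumes "finite I" "I \<noteq> {}" "r > 1" "i \<in> I"
    and eq: "real (card I) * norm ((\<Sum>i\<in>I. z i) /\<^sub>R real (card I)) powr r = (\<Sum>i\<in>I. norm (z i) powr r)"
  shows "z i = (\<Sum>i\<in>I. z i) /\<^sub>R real (card I)"
proof (rule ccontr)
  assume "z i \<noteq> (\<Sum>i\<in>I. z i) /\<^sub>R real (card I)"
  then have "real (card I) * norm ((\<Sum>i\<in>I. z i) /\<^sub>R real (card I)) powr r < (\<Sum>i\<in>I. norm (z i) powr r)"
    unfolding sum_tangent_average[OF assms(1,2) refl, of z r, symmetric]
    using assms by (intro sum_strict_mono_ex1 ballI norm_powr_tangent bexI[of _ i] norm_powr_tangent_strict) auto
  then show False using eq by simp
qed

section \<open>Additive characters and their orthogonality\<close>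

lemma echar_eq_cis: "echar (t :: 'n::nontriv mod_ring) = cis (2 * pi * of_int (to_int_mod_ring t) / real CARD('n))"
  by (simp add: echar_def cis_conv_exp mult_ac)

lemma norm_echar [simp]: "cmod (echar t) = 1"
  by (simp add: echar_eq_cis)

lemma echar_zero [simp]: "echar 0 = 1"
  by (simp add: echar_eq_cis)

text \<open>The representative of \<open>s + t\<close> differs from the sum of the representatives
  by a multiple of N, which changes the angle by a multiple of 2 pi.\<close>

lemma echar_add: "echar (s + t :: 'n::nontriv mod_ring) = echar s * echar t"
proof -
  let ?N = "int CARD('n)"
  define a where "a = to_int_mod_ring s + to_int_mod_ring t"
  have t: "to_int_mod_ring (s + t) = a mod ?N"
    unfolding a_def by (rule to_int_mod_ring_add)
  have "real_of_int a = of_int (a mod ?N) + of_int (a div ?N) * real CARD('n)"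
    by (metis add.commute mult_div_mod_eq mult.commute of_int_add of_int_mult of_int_of_nat_eq)
  then have "2 * pi * real_of_int a / real CARD('n) =
      2 * pi * of_int (a mod ?N) / real CARD('n) + 2 * pi * of_int (a div ?N)"
    by (simp add: field_simps)
  then have "cis (2 * pi * real_of_int a / real CARD('n)) = cis (2 * pi * of_int (a mod ?N) / real CARD('n))"
    by (simp flip: cis_mult)
  then show ?thesis
    by (simp add: echar_eq_cis t cis_mult a_def flip: add_divide_distrib distrib_left)
qed

lemma echar_diff: "echar (s - t) = echar s * echar (- t)"
  using echar_add[of s "- t"] by simp

text \<open>A trivial value would make the representative a multiple of N, but it lies strictly
  between 0 and N.\<close>

lemma echar_neq_1:
  assumes "t \<noteq> (0 :: 'n::nontriv mod_ring)"
  shows "echar t \<noteq> 1"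
proof
  assume "echar t = 1"
  let ?k = "to_int_mod_ring t"
  have k: "0 \<le> ?k" "?k < int CARD('n)"
    using range_to_int_mod_ring[where ?'a = 'n] by fastforce+
  have "?k \<noteq> 0"
    using assms by simp
  from \<open>echar t = 1\<close> obtain n :: int
    where "2 * pi * of_int ?k / real CARD('n) = of_int (2 * n) * pi"
    by (auto simp: echar_eq_cis cis_conv_exp exp_eq_1)
  then have "real_of_int ?k = of_int (n * int CARD('n))"
    by (simp add: field_simps)
  then have "?k = n * int CARD('n)"
    by linarith
  with k \<open>?k \<noteq> 0\<close> show False
    by (metis mod_mult_self2_is_0 mod_pos_pos_trivial)
qed

lemma zdot_simps:
  "(x + y) \<odot> z = x \<odot> z + y \<odot> z" "z \<odot> (x + y) = z \<odot> x + z \<odot> y"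
  "(x - y) \<odot> z = x \<odot> z - y \<odot> z" "z \<odot> (x - y) = z \<odot> x - z \<odot> y"
  "0 \<odot> z = 0" "z \<odot> 0 = 0"
  by (simp_all add: zdot_def algebra_simps sum.distrib sum_subtractf)

text \<open>This carries the linear part of an affine map from positions to frequencies.\<close>

lemma zdot_matrix_vector_mult: "(A *v x) \<odot> y = x \<odot> (transpose A *v y)"
  unfolding zdot_def matrix_vector_mult_def transpose_def
  by (simp add: sum_distrib_left sum_distrib_right mult_ac) (rule sum.swap)

text \<open>If \<open>z $ i\<close> is nonzero, shifting the summation variable by the unit vector
  \<open>axis i 1\<close> multiplies the sum by \<open>echar (z $ i)\<close>, which is not 1; so the
  sum vanishes.\<close>

lemma sum_echar:
  fixes z :: "('n::nontriv mod_ring) ^ 'd"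
  shows "(\<Sum>\<xi>\<in>UNIV. echar (z \<odot> \<xi>)) = (if z = 0 then of_nat CARD(('n mod_ring) ^ 'd) else 0)"
proof (cases "z = 0")
  case True
  then show ?thesis by (simp add: zdot_simps)
next
  case False
  then obtain i where i: "z $ i \<noteq> 0" by (auto simp: vec_eq_iff)
  have "z \<odot> axis i 1 = (\<Sum>j\<in>UNIV. if j = i then z $ j else 0)"
    unfolding zdot_def by (intro sum.cong) (auto simp: axis_def)
  then have e: "echar (z \<odot> axis i 1) \<noteq> 1"
    using echar_neq_1[OF i] by simp
  have "(\<Sum>\<xi>\<in>UNIV. echar (z \<odot> \<xi>)) = (\<Sum>\<xi>\<in>UNIV. echar (z \<odot> (\<xi> + axis i 1)))"
    by (rule sum.reindex_bij_betw[symmetric]) (auto intro!: bij_betwI[where g = "\<lambda>x. x - axis i 1"])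
  also have "\<dots> = (\<Sum>\<xi>\<in>UNIV. echar (z \<odot> \<xi>)) * echar (z \<odot> axis i 1)"
    by (simp add: zdot_simps echar_add sum_distrib_right)
  finally show ?thesis using e False by simp
qed

section \<open>Inversion, symmetries and norms of the Fourier transform\<close>

text \<open>Orthogonality of characters after exchanging the two sums. The factor on the right,
  equal to N^(d/2), is left unsimplified: injectivity only requires it to be nonzero.\<close>

lemma fourier_inversion:
  fixes f :: "('n::nontriv mod_ring) ^ 'd \<Rightarrow> complex"
  shows "(\<Sum>\<xi>\<in>UNIV. fourier f \<xi> * echar (y \<odot> \<xi>)) =
    of_real (real CARD('n) powr (- real CARD('d) / 2)) * of_nat CARD(('n mod_ring) ^ 'd) * f y"
proof -
  let ?k = "of_real (real CARD('n) powr (- real CARD('d) / 2)) :: complex"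
  have "(\<Sum>\<xi>\<in>UNIV. fourier f \<xi> * echar (y \<odot> \<xi>))
      = (\<Sum>\<xi>\<in>UNIV. \<Sum>x\<in>UNIV. ?k * f x * echar ((y - x) \<odot> \<xi>))"
    unfolding fourier_def
    by (simp add: sum_distrib_left sum_distrib_right zdot_simps mult_ac echar_diff)
  also have "\<dots> = (\<Sum>x\<in>UNIV. ?k * f x * (\<Sum>\<xi>\<in>UNIV. echar ((y - x) \<odot> \<xi>)))"
    by (subst sum.swap) (simp add: sum_distrib_left)
  also have "\<dots> = (\<Sum>x\<in>UNIV. if x = y then ?k * f x * of_nat CARD(('n mod_ring) ^ 'd) else 0)"
    by (intro sum.cong) (auto simp: sum_echar)
  finally show ?thesis by simp
qed

lemma fourier_inject:
  assumes "fourier f = fourier g"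
  shows "f = g"
proof
  fix y
  show "f y = g y"
    using fourier_inversion[of f y] fourier_inversion[of g y] assms by simp
qed

text \<open>This allows the largest frequency to be moved to the origin without changing either norm
  of the transform.\<close>

lemma fourier_modulate:
  "fourier (\<lambda>x. f x * echar (x \<odot> \<eta>)) \<xi> = fourier f (\<xi> - \<eta>)"
  unfolding fourier_def by (simp add: zdot_simps mult.assoc flip: echar_add)

lemma fourier_cmult: "fourier (\<lambda>x. c * f x) \<xi> = c * fourier f \<xi>"
  unfolding fourier_def by (simp add: sum_distrib_left mult_ac)

lemma fourier_average:
  "fourier (\<lambda>x. (\<Sum>i\<in>I. f i x) /\<^sub>R a) \<xi> = (\<Sum>i\<in>I. fourier (f i) \<xi>) /\<^sub>R a"
proof -
  have "(\<Sum>x\<in>UNIV. \<Sum>i\<in>I. f i x * echar (- (x \<odot> \<xi>))) = (\<Sum>i\<in>I. \<Sum>x\<in>UNIV. f i x * echar (- (x \<odot> \<xi>)))"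
    by (rule sum.swap)
  then show ?thesis
    unfolding fourier_def
    by (simp add: sum_distrib_right sum_distrib_left[symmetric] scaleR_sum_right[symmetric])
qed

lemma fourier_0: "fourier f (0 :: ('n::nontriv mod_ring) ^ 'd) =
    of_real (real CARD('n) powr (- real CARD('d) / 2)) * sum f UNIV"
  unfolding fourier_def by (simp add: zdot_simps)

lemma cmod_fourier_le:
  fixes f :: "('n::nontriv mod_ring) ^ 'd \<Rightarrow> complex"
  shows "cmod (fourier f \<xi>) \<le> real CARD('n) powr (- real CARD('d) / 2) * (\<Sum>x\<in>UNIV. cmod (f x))"
proof -
  have "cmod (\<Sum>x\<in>UNIV. f x * echar (- (x \<odot> \<xi>))) \<le> (\<Sum>x\<in>UNIV. cmod (f x * echar (- (x \<odot> \<xi>))))"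
    by (rule norm_sum)
  then show ?thesis
    unfolding fourier_def by (simp add: norm_mult mult_left_mono)
qed

lemma lnorm_translate:
  fixes F :: "'a::{finite,ab_group_add} \<Rightarrow> complex"
  shows "lnorm r (\<lambda>\<xi>. F (\<xi> - \<eta>)) = lnorm r F"
proof -
  have "(\<Sum>x\<in>UNIV. cmod (F (x - \<eta>)) powr r) = (\<Sum>x\<in>UNIV. cmod (F x) powr r)"
    by (rule sum.reindex_bij_betw) (auto intro!: bij_betwI[where g = "\<lambda>x. x + \<eta>"])
  then show ?thesis by (simp add: lnorm_def)
qed

lemma linfnorm_translate:
  fixes F :: "'a::{finite,ab_group_add} \<Rightarrow> complex"
  shows "linfnorm (\<lambda>\<xi>. F (\<xi> - \<eta>)) = linfnorm F"
proof -
  have "range (\<lambda>\<xi>. cmod (F (\<xi> - \<eta>))) = range (\<lambda>\<xi>. cmod (F \<xi>))"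
    by (auto simp: image_iff) (metis add_diff_cancel)
  then show ?thesis by (simp add: linfnorm_def)
qed

lemma cmod_le_linfnorm: "cmod (F x) \<le> linfnorm F"
  unfolding linfnorm_def by (rule Max_ge) auto

lemma linfnorm_attained: "\<exists>x. linfnorm F = cmod (F x)"
proof -
  have "linfnorm F \<in> range (\<lambda>x. cmod (F x))"
    unfolding linfnorm_def by (rule Max_in) auto
  then show ?thesis by auto
qed

lemma lnorm_cmult:
  assumes "r > 0"
  shows "lnorm r (\<lambda>x. c * F x) = cmod c * lnorm r F"
  using assms
  by (simp add: lnorm_def norm_mult powr_mult sum_nonneg powr_powr flip: sum_distrib_left)

lemma linfnorm_cmult: "linfnorm (\<lambda>x. c * F x) = cmod c * linfnorm F"
proof (rule antisym)
  show "linfnorm (\<lambda>x. c * F x) \<le> cmod c * linfnorm F"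
    using linfnorm_attained[of "\<lambda>x. c * F x"]
    by (auto simp: norm_mult intro!: mult_left_mono cmod_le_linfnorm)
  show "cmod c * linfnorm F \<le> linfnorm (\<lambda>x. c * F x)"
    using linfnorm_attained[of F] cmod_le_linfnorm[of "\<lambda>x. c * F x"] by (auto simp: norm_mult)
qed

text \<open>Injectivity of the transform keeps the denominator of the synthesis quotient
  nonzero.\<close>

lemma lnorm_fourier_pos:
  assumes "f \<noteq> (\<lambda>_. 0)"
  shows "lnorm r (fourier f) > 0"
proof -
  have "fourier f \<noteq> fourier (\<lambda>_. 0)"
    using assms fourier_inject by blast
  then obtain \<xi> where "fourier f \<xi> \<noteq> 0"
    by (auto simp: fun_eq_iff fourier_def)
  then have "(\<Sum>\<xi>\<in>UNIV. cmod (fourier f \<xi>) powr r) > 0"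
    by (intro sum_pos2[of _ \<xi>]) auto
  then show ?thesis by (simp add: lnorm_def)
qed

text \<open>The triangle inequality gives the upper bound. It is attained at frequency 0, where all
  characters equal 1.\<close>

lemma linfnorm_fourier_indicator:
  fixes S :: "(('n::nontriv mod_ring) ^ 'd) set"
  shows "linfnorm (fourier (indicator S)) = real CARD('n) powr (- real CARD('d) / 2) * real (card S)"
proof (rule antisym)
  have eq: "(\<Sum>x\<in>UNIV. cmod (indicator S x)) = real (card S)"
    by (simp add: indicator_def of_bool_def if_distrib sum.If_cases cong: if_cong)
  show "linfnorm (fourier (indicator S)) \<le> real CARD('n) powr (- real CARD('d) / 2) * real (card S)"
    using linfnorm_attained[of "fourier (indicator S)"] cmod_fourier_le[of "indicator S"] eq by metis
  have "sum (indicator S) UNIV = (of_nat (card S) :: complex)"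
    by (simp add: indicator_def of_bool_def sum.If_cases)
  then show "real CARD('n) powr (- real CARD('d) / 2) * real (card S) \<le> linfnorm (fourier (indicator S))"
    using cmod_le_linfnorm[of "fourier (indicator S)" 0] by (simp add: fourier_0 norm_mult)
qed

section \<open>Affine changes of variable on the Fourier side\<close>

lemma bij_matrix_vector_mult:
  fixes A :: "'a::comm_semiring_1 ^ 'd ^ 'd"
  assumes "invertible A"
  shows "bij (\<lambda>x. A *v x)"
proof -
  obtain B where "A ** B = mat 1" "B ** A = mat 1"
    using assms by (auto simp: invertible_def)
  then show ?thesis
    by (intro bijI'[of "\<lambda>x. A *v x"]) (metis matrix_vector_mul_assoc matrix_vector_mul_lid)+
qed

lemma invertible_transpose:
  fixes A :: "'a::comm_semiring_1 ^ 'd ^ 'd"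
  assumes "invertible A"
  shows "invertible (transpose A)"
proof -
  obtain B where "A ** B = mat 1" "B ** A = mat 1"
    using assms by (auto simp: invertible_def)
  then have "transpose B ** transpose A = mat 1" "transpose A ** transpose B = mat 1"
    by (metis matrix_transpose_mul transpose_mat)+
  then show ?thesis by (auto simp: invertible_def)
qed

lemma invertible_affine_bij:
  assumes "invertible_affine T"
  shows "bij T"
proof -
  obtain A b where A: "invertible A" "T = (\<lambda>x. A *v x + b)"
    using assms by (auto simp: invertible_affine_def)
  have "bij (\<lambda>x. x + b)"
    by (rule bijI'[of "\<lambda>x. x + b"]) (auto intro: exI[of _ "_ - b"])
  from bij_comp[OF bij_matrix_vector_mult[OF A(1)] this] show ?thesis
    by (simp add: A(2) o_def)
qed

text \<open>Substituting \<open>T x\<close> for \<open>x\<close> shows that composition with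
  \<open>T\<close> permutes the frequencies by the transpose of \<open>A\<close> and multiplies the
  values by phases coming from \<open>b\<close>. Neither affects a sum over all frequencies of
  powers of the modulus.\<close>

lemma sum_cmod_fourier_affine:
  fixes g :: "('n::nontriv mod_ring) ^ 'd \<Rightarrow> complex"
  assumes "invertible_affine T"
  shows "(\<Sum>\<xi>\<in>UNIV. cmod (fourier (\<lambda>x. g (T x)) \<xi>) powr r) = (\<Sum>\<xi>\<in>UNIV. cmod (fourier g \<xi>) powr r)"
proof -
  obtain A b where A: "invertible A" and T: "T = (\<lambda>x. A *v x + b)"
    using assms by (auto simp: invertible_affine_def)
  have "cmod (fourier (\<lambda>x. g (T x)) (transpose A *v \<eta>)) = cmod (fourier g \<eta>)" for \<eta>
  proof -
    \<comment> \<open>Here \<open>A *v x\<close> is \<open>T x - b\<close>, so the character splits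
      into one in \<open>T x\<close> and the phase \<open>echar (b \<odot> \<eta>)\<close>.\<close>
    have "(\<Sum>x\<in>UNIV. g (T x) * echar (- (x \<odot> (transpose A *v \<eta>))))
        = (\<Sum>x\<in>UNIV. g (T x) * echar (- (T x \<odot> \<eta>)) * echar (b \<odot> \<eta>))"
      by (simp add: T zdot_simps mult.assoc zdot_matrix_vector_mult[symmetric] del: transpose_matrix_vector
          flip: echar_add)
    also have "\<dots> = (\<Sum>x\<in>UNIV. g x * echar (- (x \<odot> \<eta>)) * echar (b \<odot> \<eta>))"
      by (rule sum.reindex_bij_betw[OF invertible_affine_bij[OF assms]])
    finally show ?thesis
      by (simp add: fourier_def norm_mult flip: sum_distrib_right)
  qed
  then have "(\<Sum>\<xi>\<in>UNIV. cmod (fourier g \<xi>) powr r)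
      = (\<Sum>\<xi>\<in>UNIV. cmod (fourier (\<lambda>x. g (T x)) (transpose A *v \<xi>)) powr r)"
    by simp
  also have "\<dots> = (\<Sum>\<xi>\<in>UNIV. cmod (fourier (\<lambda>x. g (T x)) \<xi>) powr r)"
    by (rule sum.reindex_bij_betw[OF bij_matrix_vector_mult[OF invertible_transpose[OF A]]])
  finally show ?thesis by simp
qed

lemma lnorm_powr:
  assumes "r > 0"
  shows "lnorm r F powr r = (\<Sum>x\<in>UNIV. cmod (F x) powr r)"
  using assms by (simp add: lnorm_def powr_powr sum_nonneg)

section \<open>Averaging over a family of affine maps\<close>

lemma sum_cmod_fourier_affine_family:
  fixes g :: "('n::nontriv mod_ring) ^ 'd \<Rightarrow> complex"
  assumes "\<forall>T\<in>\<Gamma>. invertible_affine T"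
  shows "(\<Sum>\<xi>\<in>UNIV. \<Sum>T\<in>\<Gamma>. cmod (fourier (\<lambda>x. g (T x)) \<xi>) powr r)
    = real (card \<Gamma>) * (\<Sum>\<xi>\<in>UNIV. cmod (fourier g \<xi>) powr r)"
  using assms by (subst sum.swap) (simp add: sum_cmod_fourier_affine)

text \<open>Jensen's inequality at each frequency, summed over the frequencies; by affine invariance
  every \<open>T\<close> contributes the same total.\<close>

lemma lnorm_fourier_orbit_average_le:
  fixes g :: "('n::nontriv mod_ring) ^ 'd \<Rightarrow> complex"
  assumes "\<forall>T\<in>\<Gamma>. invertible_affine T" "\<Gamma> \<noteq> {}" "r \<ge> 1"
  shows "lnorm r (fourier (\<lambda>x. (\<Sum>T\<in>\<Gamma>. g (T x)) /\<^sub>R real (card \<Gamma>))) \<le> lnorm r (fourier g)"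
proof -
  let ?h = "\<lambda>x. (\<Sum>T\<in>\<Gamma>. g (T x)) /\<^sub>R real (card \<Gamma>)"
  have fin: "finite \<Gamma>" by (rule finite)
  have "real (card \<Gamma>) * (\<Sum>\<xi>\<in>UNIV. cmod (fourier ?h \<xi>) powr r)
      \<le> (\<Sum>\<xi>\<in>UNIV. \<Sum>T\<in>\<Gamma>. cmod (fourier (\<lambda>x. g (T x)) \<xi>) powr r)"
    unfolding sum_distrib_left fourier_average
    by (intro sum_mono norm_average_powr_le fin assms)
  then have "(\<Sum>\<xi>\<in>UNIV. cmod (fourier ?h \<xi>) powr r) \<le> (\<Sum>\<xi>\<in>UNIV. cmod (fourier g \<xi>) powr r)"
    using assms fin by (simp add: sum_cmod_fourier_affine_family card_gt_0_iff)
  then show ?thesis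
    unfolding lnorm_def using assms(3) by (intro powr_mono2 sum_nonneg) simp_all
qed

text \<open>Equal totals and termwise inequalities force equality in Jensen at every frequency.
  Strict convexity then makes the transforms agree there, and inversion gives equality of the
  functions.\<close>

lemma lnorm_fourier_orbit_average_eqD:
  fixes g :: "('n::nontriv mod_ring) ^ 'd \<Rightarrow> complex"
  assumes "\<forall>T\<in>\<Gamma>. invertible_affine T" "T \<in> \<Gamma>" "r > 1"
    and eq: "lnorm r (fourier (\<lambda>x. (\<Sum>T\<in>\<Gamma>. g (T x)) /\<^sub>R real (card \<Gamma>))) = lnorm r (fourier g)"
  shows "(\<lambda>x. g (T x)) = (\<lambda>x. (\<Sum>T\<in>\<Gamma>. g (T x)) /\<^sub>R real (card \<Gamma>))"
proof (rule fourier_inject, rule ext)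
  fix \<xi>
  let ?h = "\<lambda>x. (\<Sum>T\<in>\<Gamma>. g (T x)) /\<^sub>R real (card \<Gamma>)"
  let ?L = "\<lambda>\<xi>. real (card \<Gamma>) * cmod (fourier ?h \<xi>) powr r"
  let ?R = "\<lambda>\<xi>. \<Sum>T\<in>\<Gamma>. cmod (fourier (\<lambda>x. g (T x)) \<xi>) powr r"
  have fin: "finite \<Gamma>" by (rule finite)
  have le: "?L \<xi> \<le> ?R \<xi>" for \<xi>
    unfolding fourier_average using assms by (intro norm_average_powr_le fin) auto
  have "sum ?L UNIV = sum ?R UNIV"
    using assms(1,3) eq lnorm_powr[of r "fourier ?h"] lnorm_powr[of r "fourier g"]
    by (simp add: sum_cmod_fourier_affine_family flip: sum_distrib_left)
  then have "?L \<xi> = ?R \<xi>"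
    using sum_mono_inv[of ?L UNIV ?R \<xi>] le by simp
  moreover have "\<Gamma> \<noteq> {}" using assms(2) by blast
  ultimately show "fourier (\<lambda>x. g (T x)) \<xi> = fourier ?h \<xi>"
    using norm_average_powr_eqD[OF fin _ assms(3) assms(2)] unfolding fourier_average by blast
qed

text \<open>The average is invariant under the group, hence constant on the single orbit
  \<open>S\<close>; the constant is found by summing over \<open>S\<close>, and outside
  \<open>S\<close> every term vanishes.\<close>

lemma orbit_average_eq_indicator:
  fixes g :: "'a::finite \<Rightarrow> complex"
  assumes \<Gamma>: "subgroup \<Gamma> (BijGroup UNIV)"
    and "S \<noteq> {}" "preserves \<Gamma> S" "acts_transitively_on \<Gamma> S" "supp g \<subseteq> S"
  shows "(\<lambda>x. (\<Sum>T\<in>\<Gamma>. g (T x)) /\<^sub>R real (card \<Gamma>)) = (\<lambda>x. (sum g UNIV / of_nat (card S)) * indicator S x)"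
proof
  fix x
  let ?h = "\<lambda>x. (\<Sum>T\<in>\<Gamma>. g (T x)) /\<^sub>R real (card \<Gamma>)"
  have bij: "bij T" if "T \<in> \<Gamma>" for T
    using subgroup.subset[OF \<Gamma>] that by (auto simp: BijGroup_def Bij_def)
  have comp: "T \<circ> U \<in> \<Gamma>" if "T \<in> \<Gamma>" "U \<in> \<Gamma>" for T U
    using subgroup.m_closed[OF \<Gamma> that] subgroup.subset[OF \<Gamma>] that
    by (auto simp: BijGroup_def compose_def o_def restrict_def subset_iff)
  have img: "T ` S = S" if "T \<in> \<Gamma>" for T
    using assms that by (auto simp: preserves_def)
  have card: "card \<Gamma> \<noteq> 0"
    using subgroup.one_closed[OF \<Gamma>] by auto
  have inv: "?h (U x) = ?h x" if "U \<in> \<Gamma>" for U x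
  proof -
    \<comment> \<open>Right composition with \<open>U\<close> permutes the group: it is injective
      because \<open>U\<close> is onto, and an injective self-map of a finite set is
      surjective.\<close>
    have inj: "inj_on (\<lambda>T. T \<circ> U) \<Gamma>"
      using bij_is_surj[OF bij[OF that]] by (auto simp: inj_on_def intro: surj_fun_eq[of U UNIV])
    have "(\<lambda>T. T \<circ> U) ` \<Gamma> = \<Gamma>"
      using comp that inj by (intro endo_inj_surj) auto
    then have "(\<Sum>T\<in>\<Gamma>. g (T x)) = (\<Sum>T\<in>\<Gamma>. g ((T \<circ> U) x))"
      using sum.reindex[OF inj, of "\<lambda>T. g (T x)"] by (simp add: o_def)
    then show ?thesis by simp
  qed
  have g0: "g y = 0" if "y \<notin> S" for y
    using assms that by (auto simp: supp_def)
  show "?h x = (sum g UNIV / of_nat (card S)) * indicator S x"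
  proof (cases "x \<in> S")
    case False
    have "T x \<notin> S" if "T \<in> \<Gamma>" for T
      using False img[OF that] bij_is_inj[OF bij[OF that]] by (metis inj_image_mem_iff)
    then show ?thesis using False g0 by simp
  next
    case True
    have const: "?h y = ?h x" if "y \<in> S" for y
    proof -
      obtain U where "U \<in> \<Gamma>" "U x = y"
        using assms(4) True \<open>y \<in> S\<close> unfolding acts_transitively_on_def by blast
      then show ?thesis using inv[of U x] by simp
    qed
    \<comment> \<open>Each \<open>T\<close> permutes \<open>S\<close>, so after exchanging the sums
      every inner sum is the total mass of \<open>g\<close>.\<close>
    have "of_nat (card S) * ?h x = (\<Sum>y\<in>S. ?h x)"
      by simp
    also have "\<dots> = sum ?h S"
      by (rule sum.cong) (simp_all only: const)
    also have "\<dots> = (\<Sum>T\<in>\<Gamma>. \<Sum>y\<in>S. g (T y)) /\<^sub>R real (card \<Gamma>)"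
      by (subst sum.swap) (simp add: scaleR_sum_right)
    also have "(\<Sum>T\<in>\<Gamma>. \<Sum>y\<in>S. g (T y)) = (\<Sum>T\<in>\<Gamma>. sum g S)"
    proof (rule sum.cong[OF refl])
      fix T assume "T \<in> \<Gamma>"
      then have "bij_betw T S S"
        using img bij by (metis bij_betw_def bij_is_inj inj_on_subset subset_UNIV)
      then show "(\<Sum>y\<in>S. g (T y)) = sum g S"
        by (rule sum.reindex_bij_betw)
    qed
    also have "sum g S = sum g UNIV"
      using g0 by (intro sum.mono_neutral_left) auto
    finally have "of_nat (card S) * ?h x = sum g UNIV"
      using card by (simp add: scaleR_conv_of_real field_simps)
    moreover have "card S \<noteq> 0" using assms by simp
    ultimately show ?thesis using True by (simp add: field_simps)
  qed
qed

theorem theorem4p1: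
  fixes \<Gamma> :: "(('n::nontriv mod_ring) ^ 'd \<Rightarrow> ('n mod_ring) ^ 'd) set"
    and S :: "(('n mod_ring) ^ 'd) set"
    and r :: real
  assumes "affine_group \<Gamma>"
    and "S \<noteq> {}"
    and "preserves \<Gamma> S"
    and "acts_transitively_on \<Gamma> S"
    and "1 \<le> r"
  shows "synthesis_const r S =
      real CARD('n) powr (- real CARD('d) / 2) * real (card S) / lnorm r (fourier (indicator S))
    \<and> (1 < r \<longrightarrow>
        {f. f \<noteq> (\<lambda>_. 0) \<and> supp f \<subseteq> S \<and>
            linfnorm (fourier f) = synthesis_const r S * lnorm r (fourier f)}
        = {f. \<exists>c \<xi>\<^sub>0. c \<noteq> 0 \<and> f = (\<lambda>x. c * echar (x \<odot> \<xi>\<^sub>0) * indicator S x)})"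
proof -
  define \<kappa> where "\<kappa> = real CARD('n) powr (- real CARD('d) / 2)"
  define L where "L = lnorm r (fourier (indicator S :: ('n mod_ring) ^ 'd \<Rightarrow> complex))"
  define M where "M = \<kappa> * real (card S) / L"
  have \<Gamma>: "subgroup \<Gamma> (BijGroup UNIV)" "\<forall>T\<in>\<Gamma>. invertible_affine T"
    using assms(1) by (auto simp: affine_group_def)
  have \<Gamma>_ne: "\<Gamma> \<noteq> {}" using subgroup.one_closed[OF \<Gamma>(1)] by auto
  have \<kappa>: "\<kappa> > 0" by (simp add: \<kappa>_def)
  have cS: "card S > 0" using assms(2) by (simp add: card_gt_0_iff)
  have ind_ne: "indicator S \<noteq> (\<lambda>_. 0 :: complex)"
    using assms(2) by (auto simp: fun_eq_iff indicator_def)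
  have L: "L > 0" unfolding L_def by (rule lnorm_fourier_pos[OF ind_ne])
  have M: "M > 0" using \<kappa> cS L by (simp add: M_def)
  have ind: "linfnorm (fourier (indicator S)) = M * L"
    using L by (simp add: linfnorm_fourier_indicator M_def \<kappa>_def)

  \<comment> \<open>The bound and its equality case are proved together, since both compare
    \<open>f\<close> with the same averaged function.\<close>
  have main: "linfnorm (fourier f) \<le> M * lnorm r (fourier f) \<and>
      (r > 1 \<longrightarrow> linfnorm (fourier f) = M * lnorm r (fourier f) \<longrightarrow>
        (\<exists>c \<xi>\<^sub>0. f = (\<lambda>x. c * echar (x \<odot> \<xi>\<^sub>0) * indicator S x)))"
    if sup: "supp f \<subseteq> S" for f :: "('n mod_ring) ^ 'd \<Rightarrow> complex"
  proof -
    obtain \<xi>\<^sub>0 where \<xi>\<^sub>0: "linfnorm (fourier f) = cmod (fourier f \<xi>\<^sub>0)"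
      using linfnorm_attained by blast
    define g where "g = (\<lambda>x. f x * echar (x \<odot> (- \<xi>\<^sub>0)))"
    define m where "m = sum g UNIV / of_nat (card S)"
    let ?h = "\<lambda>x. (\<Sum>T\<in>\<Gamma>. g (T x)) /\<^sub>R real (card \<Gamma>)"
    have Fg: "fourier g = (\<lambda>\<xi>. fourier f (\<xi> - (- \<xi>\<^sub>0)))"
      by (rule ext) (simp only: g_def fourier_modulate)
    have lg: "lnorm r (fourier g) = lnorm r (fourier f)"
      by (simp only: Fg lnorm_translate)
    have supg: "supp g \<subseteq> S" using sup by (auto simp: g_def supp_def)
    have h: "?h = (\<lambda>x. m * indicator S x)"
      unfolding m_def using assms \<Gamma> supg by (intro orbit_average_eq_indicator)
    have lh: "lnorm r (fourier ?h) = cmod m * L"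
      unfolding h using assms(5) by (simp add: fourier_cmult[abs_def] lnorm_cmult L_def)
    have "linfnorm (fourier f) = cmod (fourier g 0)"
      using \<xi>\<^sub>0 by (simp add: Fg)
    \<comment> \<open>By the choice of \<open>M\<close>, the product \<open>M * L\<close> is
      \<open>\<kappa> * card S\<close>, while |S| times \<open>m\<close> is the total mass of
      \<open>g\<close>. The bound is thus reduced to comparing the norms of the transforms of
      \<open>?h\<close> and \<open>g\<close>.\<close>
    also have "\<dots> = M * (cmod m * L)"
      using L cS \<kappa> by (simp add: fourier_0 norm_mult norm_divide m_def M_def \<kappa>_def assms(2))
    finally have lf: "linfnorm (fourier f) = M * lnorm r (fourier ?h)"
      by (simp only: lh)
    have le: "lnorm r (fourier ?h) \<le> lnorm r (fourier g)"
      using \<Gamma> \<Gamma>_ne assms by (intro lnorm_fourier_orbit_average_le)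
    show ?thesis
    proof (intro conjI impI)
      show "linfnorm (fourier f) \<le> M * lnorm r (fourier f)"
        unfolding lf using le lg M by simp
      assume r: "r > 1" and "linfnorm (fourier f) = M * lnorm r (fourier f)"
      then have eq: "lnorm r (fourier ?h) = lnorm r (fourier g)"
        using lf lg M by simp
      \<comment> \<open>Equality makes all compositions of \<open>g\<close> with group elements
        equal to the average; taking the identity shows that \<open>g\<close> itself is a multiple
        of the indicator.\<close>
      have one: "id \<in> \<Gamma>"
        using subgroup.one_closed[OF \<Gamma>(1)] by (simp add: BijGroup_def id_def restrict_def)
      have "(\<lambda>x. g (id x)) = ?h"
        by (rule lnorm_fourier_orbit_average_eqD[OF \<Gamma>(2) one r eq])
      then have g: "g x = m * indicator S x" for x
        unfolding h id_apply by (rule fun_cong)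
      have "f x = m * echar (x \<odot> \<xi>\<^sub>0) * indicator S x" for x
      proof -
        \<comment> \<open>The two modulations cancel, which recovers \<open>f\<close> from
          \<open>g\<close>.\<close>
        have "echar (x \<odot> (- \<xi>\<^sub>0)) * echar (x \<odot> \<xi>\<^sub>0) = echar (x \<odot> (- \<xi>\<^sub>0 + \<xi>\<^sub>0))"
          by (simp only: zdot_simps echar_add)
        then have "f x = g x * echar (x \<odot> \<xi>\<^sub>0)"
          by (simp add: g_def mult.assoc zdot_simps)
        then show ?thesis by (simp add: g mult_ac)
      qed
      then show "\<exists>c \<xi>\<^sub>0. f = (\<lambda>x. c * echar (x \<odot> \<xi>\<^sub>0) * indicator S x)" by blast
    qed
  qed

  \<comment> \<open>The supremum is a maximum, attained at the indicator of
    \<open>S\<close>.\<close>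
  have C: "synthesis_const r S = M"
    unfolding synthesis_const_def
  proof (rule cSup_eq_maximum)
    have "M = linfnorm (fourier (indicator S)) / lnorm r (fourier (indicator S))"
      using L by (simp add: ind flip: L_def)
    moreover have "supp (indicator S :: _ \<Rightarrow> complex) \<subseteq> S"
      by (auto simp: supp_def indicator_def split: if_splits)
    ultimately show "M \<in> {linfnorm (fourier f) / lnorm r (fourier f) | f. f \<noteq> (\<lambda>_. 0) \<and> supp f \<subseteq> S}"
      using ind_ne by blast
  next
    fix c assume "c \<in> {linfnorm (fourier f) / lnorm r (fourier f) | f. f \<noteq> (\<lambda>_. 0) \<and> supp f \<subseteq> S}"
    then obtain f :: "('n mod_ring) ^ 'd \<Rightarrow> complex"
      where "c = linfnorm (fourier f) / lnorm r (fourier f)" "f \<noteq> (\<lambda>_. 0)" "supp f \<subseteq> S"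
      by blast
    then show "c \<le> M"
      using main[of f] lnorm_fourier_pos[of f r] by (simp add: divide_le_eq)
  qed

  \<comment> \<open>Modulation translates the transform and \<open>c\<close> scales both norms
    alike, so the quotient is that of the indicator.\<close>
  have mod: "f \<noteq> (\<lambda>_. 0) \<and> supp f \<subseteq> S \<and> linfnorm (fourier f) = M * lnorm r (fourier f)"
    if "c \<noteq> 0" and f: "f = (\<lambda>x. c * echar (x \<odot> \<xi>\<^sub>0) * indicator S x)" for f c \<xi>\<^sub>0
  proof -
    have e0: "echar t \<noteq> 0" for t :: "'n mod_ring"
      using norm_echar[of t] by (metis norm_zero zero_neq_one)
    have f': "f = (\<lambda>x. c * (indicator S x * echar (x \<odot> \<xi>\<^sub>0)))"
      by (simp add: f mult_ac)
    have "fourier f = (\<lambda>\<xi>. c * fourier (indicator S) (\<xi> - \<xi>\<^sub>0))"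
      by (rule ext) (simp only: f' fourier_cmult fourier_modulate)
    then have "linfnorm (fourier f) = cmod c * (M * L)" "lnorm r (fourier f) = cmod c * L"
      using assms(5) by (simp_all add: linfnorm_cmult lnorm_cmult L_def
          linfnorm_translate[of "fourier (indicator S)"] lnorm_translate[of r "fourier (indicator S)"] ind)
    moreover have "f \<noteq> (\<lambda>_. 0)"
      using assms(2) \<open>c \<noteq> 0\<close> e0 by (auto simp: f fun_eq_iff indicator_def)
    moreover have "supp f \<subseteq> S"
      by (auto simp: f supp_def indicator_def split: if_splits)
    ultimately show ?thesis by simp
  qed

  have "{f. f \<noteq> (\<lambda>_. 0) \<and> supp f \<subseteq> S \<and> linfnorm (fourier f) = M * lnorm r (fourier f)}
      = {f. \<exists>c \<xi>\<^sub>0. c \<noteq> 0 \<and> f = (\<lambda>x. c * echar (x \<odot> \<xi>\<^sub>0) * indicator S x)}" if "r > 1"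
  proof (intro equalityI subsetI CollectI; elim CollectE conjE exE)
    fix f :: "('n mod_ring) ^ 'd \<Rightarrow> complex"
    assume f: "f \<noteq> (\<lambda>_. 0)" "supp f \<subseteq> S" "linfnorm (fourier f) = M * lnorm r (fourier f)"
    then obtain c \<xi>\<^sub>0 where c: "f = (\<lambda>x. c * echar (x \<odot> \<xi>\<^sub>0) * indicator S x)"
      using main[of f] \<open>r > 1\<close> by blast
    then have "c \<noteq> 0" using f(1) by auto
    then show "\<exists>c \<xi>\<^sub>0. c \<noteq> 0 \<and> f = (\<lambda>x. c * echar (x \<odot> \<xi>\<^sub>0) * indicator S x)"
      using c by blast
  qed (rule mod)
  then show ?thesis
    unfolding C by (simp add: M_def \<kappa>_def L_def)
qed

end
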